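(* Let $\tau>0$ and consider the system $$x'(t)=k(t)y(t-\tau)-a(t)x(t-\tau)+g(t,x(t),y(t),x(t-\tau),y(t-\tau)),$$ $$y'(t)=l(t)x(t-\tau)-b(t)y(t-\tau)+h(t,y(t),x(t),y(t-\tau),x(t-\tau)),$$ with $a,b,k,l$ continuous and nonnegative functions on $[0,\infty)$, and $a(t),b(t)$ positive. Assume that: (i) $\int_0^\infty a(t)\,dt=\infty$ and $\int_0^\infty b(t)\,dt=\infty$; (ii) there are continuous functions $G,H:[0,\infty)\to[0,\infty)$ such that, for all $t\ge0$ and $(x,y,u,v)\in\mathbb R^4$, $$|g(t,x,y,u,v)|\le G(t)\,|(x,y,u,v)|,\qquad |h(t,x,y,u,v)|\le H(t)\,|(x,y,u,v)|,$$ where $|\cdot|$ on $\mathbb R^4$ is the maximum norm; (iii) $\limsup_{t\to\infty}B_i(t)<1$ for $i=1,2$, where $$B_1(t)=\frac{k(t)+G(t)}{a(t)}+\int_{t-\tau}^t(a(s)+k(s)+G(s))\,ds,$$ $$B_2(t)=\frac{l(t)+H(t)}{b(t)}+\int_{t-\tau}^t(b(s)+l(s)+H(s))\,ds.$$ Then the zero solution of the system is stable and a global attractor of all solutions. Moreover, if (ii) and (iii) hold and (i) is replaced by (i') $\liminf_{t\to\infty}a(t)>0$ and $\liminf_{t\to\infty}b(t)>0$, then the zero solution of the system is globally exponentially stable.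
   Context: Standing assumptions on the nonlinearities: $g,h:[0,\infty)\times\mathbb R^4\to\mathbb R$ are continuous and nonnegative; there are constants $\bar b_1,\bar b_2>0$ with $|g|\le\bar b_1$ and $|h|\le\bar b_2$ for all $t\ge0$ and all nonnegative values of the four state arguments; and for each $t_0\ge0$ and each initial function $\phi\in C=C([-\tau,0];\mathbb R^2)$ (supremum norm) the system has a unique solution $X(t,t_0,\phi)=(x(t),y(t))$ with $X(t_0+\theta)=\phi(\theta)$, $\theta\in[-\tau,0]$, defined on $[t_0,\infty)$. "Global attractor of all solutions" means that every solution tends to $0$ as $t\to\infty$. "Globally exponentially stable" means that there are $K,\beta>0$ with $|X(t,t_0,\phi)|\le Ke^{-\beta(t-t_0)}\|\phi\|$ for all $t\ge t_0\ge0$ and $\phi\in C$. *)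

theory Defs
  imports "HOL-Analysis.Analysis"
begin

text \<open>The norm on \<open>\<real>\<^sup>2\<close> and \<open>\<real>\<^sup>4\<close> is \<^const>\<open>infnorm\<close>, which on nested pairs of reals
  is the maximum norm.\<close>

lemma infnorm_real: "infnorm (x::real) = \<bar>x\<bar>"
  by (simp add: infnorm_def)

lemma infnorm_Pair:
  fixes x :: "'a::euclidean_space" and y :: "'b::euclidean_space"
  shows "infnorm (x, y) = max (infnorm x) (infnorm y)"
proof -
  have "infnorm (x, y) =
      Max ((\<lambda>i. \<bar>x \<bullet> i\<bar>) ` Basis \<union> (\<lambda>i. \<bar>y \<bullet> i\<bar>) ` Basis)"
    by (simp add: infnorm_Max Basis_prod_def image_Un image_image)
  then show ?thesis
    by (simp add: infnorm_Max Max_Un)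
qed

lemma infnorm_real2: "infnorm (x::real, y::real) = max \<bar>x\<bar> \<bar>y\<bar>"
  by (simp add: infnorm_Pair infnorm_real)

lemma infnorm_real4:
  "infnorm (x::real, y::real, u::real, v::real) = Max {\<bar>x\<bar>, \<bar>y\<bar>, \<bar>u\<bar>, \<bar>v\<bar>}"
  by (simp add: infnorm_Pair infnorm_real)

text \<open>The space \<open>C([-\<tau>,0]; \<real>\<^sup>2)\<close> consists of functions on the whole line of which only the
  restriction to \<open>[-\<tau>,0]\<close> is used.\<close>

definition initial_functions :: "real \<Rightarrow> (real \<Rightarrow> real \<times> real) set" where
  "initial_functions \<tau> = {\<phi>. continuous_on {-\<tau>..0} \<phi>}"

definition sup_norm :: "real \<Rightarrow> (real \<Rightarrow> real \<times> real) \<Rightarrow> real" where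
  "sup_norm \<tau> \<phi> = (SUP \<theta>\<in>{-\<tau>..0}. infnorm (\<phi> \<theta>))"

text \<open>Solutions on \<open>[t\<^sub>0, \<infinity>)\<close> of \<open>X'(t) = F t (X(t)) (X(t - \<tau>))\<close> with initial function
  \<open>\<phi>\<close> at time \<open>t\<^sub>0\<close>; at \<open>t\<^sub>0\<close> the derivative is the right-hand one.  Values of \<open>X\<close> before
  \<open>t\<^sub>0 - \<tau>\<close> are irrelevant.\<close>

definition dde_solution ::
  "real \<Rightarrow> (real \<Rightarrow> real \<times> real \<Rightarrow> real \<times> real \<Rightarrow> real \<times> real) \<Rightarrow> real
    \<Rightarrow> (real \<Rightarrow> real \<times> real) \<Rightarrow> (real \<Rightarrow> real \<times> real) \<Rightarrow> bool" where
  "dde_solution \<tau> F t0 \<phi> X \<longleftrightarrow>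
     continuous_on {t0 - \<tau>..} X \<and>
     (\<forall>\<theta>\<in>{-\<tau>..0}. X (t0 + \<theta>) = \<phi> \<theta>) \<and>
     (\<forall>t\<ge>t0. (X has_vector_derivative F t (X t) (X (t - \<tau>))) (at t within {t0..}))"

definition uniquely_solvable ::
  "real \<Rightarrow> (real \<Rightarrow> real \<times> real \<Rightarrow> real \<times> real \<Rightarrow> real \<times> real) \<Rightarrow> bool" where
  "uniquely_solvable \<tau> F \<longleftrightarrow>
     (\<forall>t0\<ge>0. \<forall>\<phi>\<in>initial_functions \<tau>.
        (\<exists>X. dde_solution \<tau> F t0 \<phi> X) \<and>
        (\<forall>X Y. dde_solution \<tau> F t0 \<phi> X \<longrightarrow> dde_solution \<tau> F t0 \<phi> Y
           \<longrightarrow> (\<forall>t\<ge>t0 - \<tau>. X t = Y t)))"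

text \<open>The following notions are meant for uniquely solvable equations that have the zero
  solution: \<open>X\<close> then stands for \<open>X(\<cdot>, t\<^sub>0, \<phi>)\<close>.  In the definition of (Lyapunov) stability,
  \<open>\<delta>\<close> may depend on \<open>t\<^sub>0\<close>.\<close>

definition zero_stable ::
  "real \<Rightarrow> (real \<Rightarrow> real \<times> real \<Rightarrow> real \<times> real \<Rightarrow> real \<times> real) \<Rightarrow> bool" where
  "zero_stable \<tau> F \<longleftrightarrow>
     (\<forall>t0\<ge>0. \<forall>\<epsilon>>0. \<exists>\<delta>>0. \<forall>\<phi>\<in>initial_functions \<tau>. \<forall>X.
        dde_solution \<tau> F t0 \<phi> X \<longrightarrow> sup_norm \<tau> \<phi> < \<delta> \<longrightarrow> (\<forall>t\<ge>t0. infnorm (X t) < \<epsilon>))"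

definition zero_global_attractor ::
  "real \<Rightarrow> (real \<Rightarrow> real \<times> real \<Rightarrow> real \<times> real \<Rightarrow> real \<times> real) \<Rightarrow> bool" where
  "zero_global_attractor \<tau> F \<longleftrightarrow>
     (\<forall>t0\<ge>0. \<forall>\<phi>\<in>initial_functions \<tau>. \<forall>X. dde_solution \<tau> F t0 \<phi> X \<longrightarrow> (X \<longlongrightarrow> 0) at_top)"

definition zero_globally_exp_stable ::
  "real \<Rightarrow> (real \<Rightarrow> real \<times> real \<Rightarrow> real \<times> real \<Rightarrow> real \<times> real) \<Rightarrow> bool" where
  "zero_globally_exp_stable \<tau> F \<longleftrightarrow>
     (\<exists>K>0. \<exists>\<beta>>0. \<forall>t0\<ge>0. \<forall>\<phi>\<in>initial_functions \<tau>. \<forall>X. dde_solution \<tau> F t0 \<phi> X \<longrightarrow>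
        (\<forall>t\<ge>t0. infnorm (X t) \<le> K * exp (- \<beta> * (t - t0)) * sup_norm \<tau> \<phi>))"

text \<open>The arguments \<open>(x, y)\<close> and \<open>(u, v)\<close> stand for \<open>X(t)\<close> and \<open>X(t - \<tau>)\<close>.  In \<open>h\<close> the two
  components are swapped.\<close>

definition planar_field ::
  "(real \<Rightarrow> real) \<Rightarrow> (real \<Rightarrow> real) \<Rightarrow> (real \<Rightarrow> real) \<Rightarrow> (real \<Rightarrow> real)
    \<Rightarrow> (real \<Rightarrow> real \<times> real \<times> real \<times> real \<Rightarrow> real)
    \<Rightarrow> (real \<Rightarrow> real \<times> real \<times> real \<times> real \<Rightarrow> real)
    \<Rightarrow> real \<Rightarrow> real \<times> real \<Rightarrow> real \<times> real \<Rightarrow> real \<times> real" where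
  "planar_field a b k l g h = (\<lambda>t (x, y) (u, v).
     (k t * v - a t * u + g t (x, y, u, v),
      l t * u - b t * v + h t (y, x, v, u)))"

end

theory Submission
  imports Defs
begin

text \<open>Write \<open>X = (x, y)\<close>, \<open>p = k + G\<close>, \<open>q = l + H\<close>.  The delayed term \<open>-a(t) x(t - \<tau>)\<close> acts as the
  damping \<open>-a(t) x(t)\<close> up to the error \<open>a(t) (x(t) - x(t - \<tau>))\<close>, and that difference is the integral
  of \<open>x'\<close>, where \<open>|x'| \<le> (a + p) N\<close> by the equation itself if \<open>N\<close> bounds the present and the delayed
  state.  Hence
  \<open>|x'(t) + a(t) x(t)| \<le> a(t) B\<^sub>1(t) N\<close> as soon as \<open>|X| \<le> N\<close> on \<open>[t - 2\<tau>, t]\<close>: one \<open>\<tau>\<close> for the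
  integral, one for the delay inside \<open>x'\<close>.  The same holds for \<open>y\<close>.  From some time on \<open>B\<^sub>1\<close> and
  \<open>B\<^sub>2\<close> are at most a constant \<open>\<theta> < 1\<close>, so that the perturbation is weaker than the damping
  (\<open>residual_bound\<close>).

  Everything else compares \<open>|x|\<close> and \<open>|y|\<close> with a barrier \<open>\<rho>\<close> (lemma \<open>barrier\<close>), which cannot be
  reached for the first time if \<open>\<rho>\<close> decreases more slowly than the damping pushes back.
  On the time interval from \<open>t\<^sub>0\<close> until the estimate above is available, the barrier is an
  exponential of \<open>\<integral> (a + p + b + q)\<close>, as in Gronwall's inequality.  Afterwards a constant barrier is
  never crossed, which is stability (\<open>trajectory_bounded\<close>).  If \<open>\<integral> a\<close> and \<open>\<integral> b\<close> diverge, a bound \<open>M\<close> on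
  \<open>|X|\<close> improves to \<open>\<eta> M\<close> for later times, for any \<open>\<eta>\<close> between \<open>\<theta>\<close> and \<open>1\<close>; iterating
  gives \<open>X \<rightarrow> 0\<close> (\<open>trajectory_tendsto_0\<close>).  If \<open>a\<close> and \<open>b\<close> are eventually at least \<open>\<alpha> > 0\<close>, the barrier
  may decrease like \<open>exp (-\<beta> t)\<close>, provided that \<open>\<beta>\<close> is so small that the factor
  \<open>exp (2 \<beta> \<tau>)\<close> lost to the delay does not use up the margin \<open>1 - \<theta>\<close> (\<open>trajectory_exponential\<close>).
  The constants there are uniform in \<open>t\<^sub>0\<close> because \<open>B\<^sub>1, B\<^sub>2 \<le> 1\<close> bounds the initial growth over
  an interval of length \<open>\<tau>\<close> for large \<open>t\<^sub>0\<close>, and small \<open>t\<^sub>0\<close> form a bounded set.\<close>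

section \<open>Comparison with a barrier\<close>

text \<open>The integrating factor \<open>exp (\<integral> a)\<close> turns the inequality into monotonicity.\<close>

lemma linear_differential_inequality_pos:
  fixes w w' a :: "real \<Rightarrow> real"
  assumes TS: "T \<le> S"
    and a: "continuous_on {T..S} a"
    and w: "\<And>t. t \<in> {T..S} \<Longrightarrow> (w has_real_derivative w' t) (at t within {T..S})"
    and ineq: "\<And>t. t \<in> {T..S} \<Longrightarrow> w' t + a t * w t \<ge> 0"
    and init: "w T > 0"
  shows "w S > 0"
proof -
  define E where "E t = exp (integral {T..t} a)" for t
  have "((\<lambda>t. E t * w t) has_real_derivative E t * (w' t + a t * w t)) (at t within {T..S})"
    if t: "t \<in> {T..S}" for t
    unfolding E_def
    by (rule derivative_eq_intros integral_has_real_derivative[OF a t] w[OF t] refl)+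
       (simp add: algebra_simps)
  then have "((\<lambda>t. E t * (w' t + a t * w t)) has_integral E S * w S - E T * w T) {T..S}"
    using TS by (intro fundamental_theorem_of_calculus)
      (auto simp: has_real_derivative_iff_has_vector_derivative)
  then have "E S * w S - E T * w T \<ge> 0"
    by (rule has_integral_nonneg) (simp add: ineq E_def)
  moreover have "E T * w T > 0"
    using init by (simp add: E_def)
  ultimately have "E S * w S > 0" by linarith
  then show ?thesis by (simp add: E_def zero_less_mult_iff)
qed

text \<open>The differential inequality is needed only as long as the barrier has not been crossed, which
  is what makes the lemma apply to delay equations: there the derivative is controlled by the past.
  At a first contact time \<open>S\<close>, each of \<open>\<rho> \<plusminus> x\<close> and \<open>\<rho> \<plusminus> y\<close> satisfies on \<open>[T, S]\<close> a linear
  inequality that keeps it positive, so there is no contact.  The coefficients \<open>a\<close> and \<open>b\<close> differ because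
  the two components may be damped at incomparable rates.\<close>

lemma barrier:
  fixes x y dx dy a b \<rho> d\<rho> :: "real \<Rightarrow> real"
  assumes ab: "continuous_on {T..} a" "continuous_on {T..} b"
    and deriv: "\<And>t. t \<ge> T \<Longrightarrow> (x has_real_derivative dx t) (at t within {T..})"
      "\<And>t. t \<ge> T \<Longrightarrow> (y has_real_derivative dy t) (at t within {T..})"
      "\<And>t. t \<ge> T \<Longrightarrow> (\<rho> has_real_derivative d\<rho> t) (at t within {T..})"
    and init: "\<bar>x T\<bar> < \<rho> T" "\<bar>y T\<bar> < \<rho> T"
    and below: "\<And>t. t \<ge> T \<Longrightarrow> (\<And>s. s \<in> {T..t} \<Longrightarrow> \<bar>x s\<bar> \<le> \<rho> s \<and> \<bar>y s\<bar> \<le> \<rho> s) \<Longrightarrow>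
      \<bar>dx t + a t * x t\<bar> \<le> d\<rho> t + a t * \<rho> t \<and> \<bar>dy t + b t * y t\<bar> \<le> d\<rho> t + b t * \<rho> t"
    and t: "t \<ge> T"
  shows "\<bar>x t\<bar> < \<rho> t \<and> \<bar>y t\<bar> < \<rho> t"
proof (rule ccontr)
  assume contra: "\<not> ?thesis"
  define m where "m s = max \<bar>x s\<bar> \<bar>y s\<bar> - \<rho> s" for s
  have cont: "continuous_on {T..} x" "continuous_on {T..} y" "continuous_on {T..} \<rho>"
    using deriv by (auto intro!: DERIV_continuous_on)
  have contm: "continuous_on {T..} m"
    unfolding m_def by (intro continuous_intros cont)
  define Z where "Z = {T..t} \<inter> m -` {0..}"
  have "continuous_on {T..t} m"
    by (rule continuous_on_subset[OF contm]) auto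
  then have "closed Z" unfolding Z_def
    by (intro continuous_closed_preimage) auto
  moreover have "bounded Z" unfolding Z_def by (rule bounded_subset[of "{T..t}"]) auto
  ultimately have "compact Z" by (simp add: compact_eq_bounded_closed)
  moreover have "t \<in> Z" using contra t by (auto simp: Z_def m_def)
  ultimately obtain S where S: "S \<in> Z" "\<And>s. s \<in> Z \<Longrightarrow> S \<le> s"
    using compact_attains_inf[of Z] by blast
  have TS: "T \<le> S" "S \<le> t" and mS: "m S \<ge> 0" using S(1) by (auto simp: Z_def)
  \<comment> \<open>At the first time \<open>S\<close> of failure the bound is attained with equality, so that the
    hypothesis \<open>below\<close> is still available at \<open>S\<close> itself.\<close>
  have "m T \<le> 0" using init by (simp add: m_def)
  moreover have "continuous_on {T..S} m"
    by (rule continuous_on_subset[OF contm]) auto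
  ultimately obtain s where s: "T \<le> s" "s \<le> S" "m s = 0"
    using IVT'[of m T 0 S] mS TS by auto
  then have "s \<in> Z" using TS by (auto simp: Z_def)
  with S(2) s have mS0: "m S = 0" by (metis order_antisym)
  have le: "\<bar>x r\<bar> \<le> \<rho> r \<and> \<bar>y r\<bar> \<le> \<rho> r" if r: "r \<in> {T..S}" for r
  proof (cases "r = S")
    case True
    then show ?thesis using mS0 by (auto simp: m_def)
  next
    case False
    then have "r \<notin> Z" using r S(2) by force
    then show ?thesis using r TS by (auto simp: Z_def m_def)
  qed
  have b': "\<bar>dx r + a r * x r\<bar> \<le> d\<rho> r + a r * \<rho> r \<and> \<bar>dy r + b r * y r\<bar> \<le> d\<rho> r + b r * \<rho> r"
    if "r \<in> {T..S}" for r
    using that le by (intro below) auto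
  have sub: "{T..S} \<subseteq> {T..}" by auto
  have ab': "continuous_on {T..S} a" "continuous_on {T..S} b"
    using ab continuous_on_subset sub by blast+
  have d: "(x has_real_derivative dx r) (at r within {T..S})"
    "(y has_real_derivative dy r) (at r within {T..S})"
    "(\<rho> has_real_derivative d\<rho> r) (at r within {T..S})" if "r \<in> {T..S}" for r
    using that deriv[of r] DERIV_subset[OF _ sub] by auto
  have "\<rho> S - x S > 0"
    by (rule linear_differential_inequality_pos[where w' = "\<lambda>r. d\<rho> r - dx r", OF TS(1) ab'(1)])
       (use init b' in \<open>force intro!: derivative_eq_intros d simp: abs_le_iff algebra_simps\<close>)+
  moreover have "\<rho> S + x S > 0"
    by (rule linear_differential_inequality_pos[where w' = "\<lambda>r. d\<rho> r + dx r", OF TS(1) ab'(1)])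
       (use init b' in \<open>force intro!: derivative_eq_intros d simp: abs_le_iff algebra_simps\<close>)+
  moreover have "\<rho> S - y S > 0"
    by (rule linear_differential_inequality_pos[where w' = "\<lambda>r. d\<rho> r - dy r", OF TS(1) ab'(2)])
       (use init b' in \<open>force intro!: derivative_eq_intros d simp: abs_le_iff algebra_simps\<close>)+
  moreover have "\<rho> S + y S > 0"
    by (rule linear_differential_inequality_pos[where w' = "\<lambda>r. d\<rho> r + dy r", OF TS(1) ab'(2)])
       (use init b' in \<open>force intro!: derivative_eq_intros d simp: abs_le_iff algebra_simps\<close>)+
  ultimately show False using mS0 by (auto simp: m_def max_def split: if_splits)
qed

lemma integral_has_real_derivative_atLeast:
  fixes f :: "real \<Rightarrow> real"
  assumes "continuous_on {T..} f" "t \<ge> T"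
  shows "((\<lambda>t. integral {T..t} f) has_real_derivative f t) (at t within {T..})"
proof -
  have "at t within {T..} = at t within {T..t + 1}"
    by (rule at_within_nhd[where S = "{..<t + 1}"]) auto
  moreover have "continuous_on {T..t + 1} f"
    by (rule continuous_on_subset[OF assms(1)]) auto
  ultimately show ?thesis
    using integral_has_real_derivative[of T "t + 1" f t] assms(2) by simp
qed

lemma integral_diverges_from:
  fixes f :: "real \<Rightarrow> real"
  assumes "continuous_on {0..} f" "filterlim (\<lambda>t. integral {0..t} f) at_top at_top" "S \<ge> 0"
  shows "filterlim (\<lambda>t. integral {S..t} f) at_top at_top"
proof -
  have "filterlim (\<lambda>t. - integral {0..S} f + integral {0..t} f) at_top at_top"
    by (rule filterlim_tendsto_add_at_top[OF tendsto_const assms(2)])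
  moreover have "\<forall>\<^sub>F t in at_top. - integral {0..S} f + integral {0..t} f \<le> integral {S..t} f"
    using eventually_ge_at_top[of S]
  proof eventually_elim
    case (elim t)
    have "f integrable_on {0..t}"
      by (intro integrable_continuous_real continuous_on_subset[OF assms(1)]) auto
    from Henstock_Kurzweil_Integration.integral_combine[OF assms(3) elim this]
    show ?case by simp
  qed
  ultimately show ?thesis by (rule filterlim_at_top_mono)
qed

text \<open>The bound \<open>N\<close> is the level at which the damping balances the perturbation; the excess over \<open>N\<close>
  decays like \<open>exp (-\<integral> a)\<close>.\<close>

lemma damped_eventually_below:
  fixes x dx a :: "real \<Rightarrow> real"
  assumes a: "continuous_on {T..} a"
    and int: "filterlim (\<lambda>t. integral {T..t} a) at_top at_top"
    and deriv: "\<And>t. t \<ge> T \<Longrightarrow> (x has_real_derivative dx t) (at t within {T..})"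
    and ineq: "\<And>t. t \<ge> T \<Longrightarrow> \<bar>dx t + a t * x t\<bar> \<le> a t * N"
    and N: "0 \<le> N" "N < N'"
  shows "\<forall>\<^sub>F t in at_top. \<bar>x t\<bar> < N'"
proof -
  define c where "c = \<bar>x T\<bar> + 1"
  define \<rho> where "\<rho> t = N + c * exp (- integral {T..t} a)" for t
  have d\<rho>: "(\<rho> has_real_derivative - a t * (\<rho> t - N)) (at t within {T..})" if "t \<ge> T" for t
    unfolding \<rho>_def
    by (rule derivative_eq_intros integral_has_real_derivative_atLeast[OF a that] refl)+ simp
  \<comment> \<open>The scalar case of \<open>barrier\<close>, obtained with two equal components.\<close>
  have "\<bar>x t\<bar> < \<rho> t" if "t \<ge> T" for t
    using barrier[OF a a deriv deriv d\<rho> _ _ _ that] ineq N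
    by (simp add: \<rho>_def c_def algebra_simps)
  then have "\<forall>\<^sub>F t in at_top. \<bar>x t\<bar> < \<rho> t"
    by (rule eventually_at_top_linorderI)
  moreover have "(\<rho> \<longlongrightarrow> N + c * 0) at_top"
    unfolding \<rho>_def
    by (intro tendsto_intros filterlim_compose[OF exp_at_bot]
        filterlim_compose[OF filterlim_uminus_at_bot_at_top] int)
  then have "\<forall>\<^sub>F t in at_top. \<rho> t < N'"
    using N by (intro order_tendstoD) auto
  ultimately show ?thesis
    by eventually_elim linarith
qed

text \<open>Replacing the delayed damping \<open>\<alpha> x(r)\<close> by the instantaneous \<open>\<alpha> x(t)\<close> costs
  \<open>\<alpha> |x(t) - x(r)|\<close>, which is at most \<open>\<alpha> N \<integral> c\<close> by integrating the bound on the derivative.\<close>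

lemma damping_residual:
  fixes x dx c :: "real \<Rightarrow> real"
  assumes r: "r \<le> t"
    and c: "continuous_on {r..t} c"
    and deriv: "\<And>s. s \<in> {r..t} \<Longrightarrow> (x has_real_derivative dx s) (at s within {r..t})"
    and bound: "\<And>s. s \<in> {r..t} \<Longrightarrow> \<bar>dx s\<bar> \<le> c s * N"
    and delayed: "\<bar>dx t + \<alpha> * x r\<bar> \<le> e * N"
    and small: "e / \<alpha> + integral {r..t} c \<le> \<theta>" and \<alpha>: "\<alpha> > 0" and N: "N \<ge> 0"
  shows "\<bar>dx t + \<alpha> * x t\<bar> \<le> \<alpha> * \<theta> * N"
proof -
  have I: "(dx has_integral x t - x r) {r..t}"
    using deriv r by (intro fundamental_theorem_of_calculus)
      (auto simp: has_real_derivative_iff_has_vector_derivative)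
  have J: "((\<lambda>s. c s * N) has_integral integral {r..t} c * N) {r..t}"
    by (intro has_integral_mult_left integrable_integral integrable_continuous_real c)
  have "x t - x r \<le> integral {r..t} c * N"
    by (rule has_integral_le[OF I J]) (use bound in force)
  moreover have "- (x t - x r) \<le> integral {r..t} c * N"
    by (rule has_integral_le[OF has_integral_neg[OF I] J]) (use bound in force)
  ultimately have "\<bar>x t - x r\<bar> \<le> integral {r..t} c * N" by linarith
  then have "\<bar>\<alpha> * (x t - x r)\<bar> \<le> \<alpha> * (integral {r..t} c * N)"
    using \<alpha> by (auto simp: abs_mult intro!: mult_left_mono)
  moreover have "dx t + \<alpha> * x t = (dx t + \<alpha> * x r) + \<alpha> * (x t - x r)"
    by (simp add: algebra_simps)
  ultimately have "\<bar>dx t + \<alpha> * x t\<bar> \<le> e * N + \<alpha> * (integral {r..t} c * N)"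
    using delayed by linarith
  also have "\<dots> = \<alpha> * (e / \<alpha> + integral {r..t} c) * N"
    using \<alpha> by (simp add: field_simps)
  also have "\<dots> \<le> \<alpha> * \<theta> * N"
    using small \<alpha> N by (intro mult_right_mono mult_left_mono) auto
  finally show ?thesis .
qed

section \<open>Delayed damping with a small perturbation\<close>

locale delayed_damping =
  fixes \<tau> :: real and a b p q :: "real \<Rightarrow> real"
  assumes tau: "\<tau> > 0"
    and cont: "continuous_on {0..} a" "continuous_on {0..} b"
      "continuous_on {0..} p" "continuous_on {0..} q"
    and pos: "\<And>t. t \<ge> 0 \<Longrightarrow> a t > 0" "\<And>t. t \<ge> 0 \<Longrightarrow> b t > 0"
    and nonneg: "\<And>t. t \<ge> 0 \<Longrightarrow> p t \<ge> 0" "\<And>t. t \<ge> 0 \<Longrightarrow> q t \<ge> 0"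
begin

text \<open>This keeps of the delay system only what the estimates need: the terms beyond the delayed
  damping are bounded by \<open>p\<close> and \<open>q\<close> times the maximum of the current and the delayed state.\<close>

definition trajectory ::
  "real \<Rightarrow> (real \<Rightarrow> real) \<Rightarrow> (real \<Rightarrow> real) \<Rightarrow> (real \<Rightarrow> real) \<Rightarrow> (real \<Rightarrow> real) \<Rightarrow> bool" where
  "trajectory t0 x y dx dy \<longleftrightarrow>
     t0 \<ge> 0 \<and>
     (\<forall>t\<ge>t0. (x has_real_derivative dx t) (at t within {t0..}) \<and>
             (y has_real_derivative dy t) (at t within {t0..})) \<and>
     (\<forall>t\<ge>t0. \<forall>N. (\<forall>s\<in>{t - \<tau>, t}. \<bar>x s\<bar> \<le> N \<and> \<bar>y s\<bar> \<le> N) \<longrightarrow>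
        \<bar>dx t + a t * x (t - \<tau>)\<bar> \<le> p t * N \<and> \<bar>dy t + b t * y (t - \<tau>)\<bar> \<le> q t * N)"

definition rate :: "real \<Rightarrow> real" where
  "rate t = (a t + p t) + (b t + q t)"

text \<open>The smallness condition in the form in which it holds from some time on.  The bound \<open>T \<ge> \<tau>\<close>
  keeps the window \<open>[t - \<tau>, t]\<close> inside \<open>[0, \<infinity>)\<close>, where the coefficients are continuous.\<close>

definition contracting :: "real \<Rightarrow> real \<Rightarrow> bool" where
  "contracting \<theta> T \<longleftrightarrow> T \<ge> \<tau> \<and> 0 < \<theta> \<and> \<theta> < 1 \<and>
     (\<forall>t\<ge>T. p t / a t + integral {t - \<tau>..t} (\<lambda>s. a s + p s) \<le> \<theta> \<and>
             q t / b t + integral {t - \<tau>..t} (\<lambda>s. b s + q s) \<le> \<theta>)"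

lemma rate_nonneg: "t \<ge> 0 \<Longrightarrow> rate t \<ge> 0"
  using pos[of t] nonneg[of t] by (simp add: rate_def)

lemma rate_cont: "continuous_on {0..} rate"
  unfolding rate_def by (intro continuous_intros cont)

lemma rate_integrable: "0 \<le> s \<Longrightarrow> rate integrable_on {s..t}"
  by (rule integrable_continuous_real, rule continuous_on_subset[OF rate_cont]) auto

lemma trajectory_deriv_bound:
  assumes "trajectory t0 x y dx dy" "t \<ge> t0" "\<And>s. s \<in> {t - \<tau>..t} \<Longrightarrow> \<bar>x s\<bar> \<le> N \<and> \<bar>y s\<bar> \<le> N"
  shows "\<bar>dx t\<bar> \<le> (a t + p t) * N \<and> \<bar>dy t\<bar> \<le> (b t + q t) * N"
proof -
  have t: "t \<ge> 0" using assms by (auto simp: trajectory_def)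
  have 1: "\<bar>dx t + a t * x (t - \<tau>)\<bar> \<le> p t * N \<and> \<bar>dy t + b t * y (t - \<tau>)\<bar> \<le> q t * N"
    using assms tau by (auto simp: trajectory_def)
  have "\<bar>x (t - \<tau>)\<bar> \<le> N" "\<bar>y (t - \<tau>)\<bar> \<le> N" using assms(3)[of "t - \<tau>"] tau by auto
  then have "\<bar>a t * x (t - \<tau>)\<bar> \<le> a t * N" "\<bar>b t * y (t - \<tau>)\<bar> \<le> b t * N"
    using pos[OF t] by (auto simp: abs_mult intro!: mult_left_mono)
  with 1 show ?thesis by (auto simp: algebra_simps)
qed

text \<open>Gronwall's estimate: the barrier \<open>\<rho>\<close> is increasing, so it also bounds the delayed state, and its
  growth rate dominates the derivatives of both components.\<close>

lemma trajectory_growth: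
  assumes tr: "trajectory t0 x y dx dy"
    and init: "\<And>s. s \<in> {t0 - \<tau>..t0} \<Longrightarrow> \<bar>x s\<bar> < M \<and> \<bar>y s\<bar> < M"
    and t: "t \<ge> t0"
  shows "\<bar>x t\<bar> < M * exp (integral {t0..t} rate) \<and> \<bar>y t\<bar> < M * exp (integral {t0..t} rate)"
proof -
  define \<rho> where "\<rho> t = M * exp (integral {t0..t} rate)" for t
  have t0: "t0 \<ge> 0" using tr by (simp add: trajectory_def)
  have M: "M > 0" using init[of t0] tau by auto
  have rc: "continuous_on {t0..} rate"
    by (rule continuous_on_subset[OF rate_cont]) (use t0 in auto)
  have d\<rho>: "(\<rho> has_real_derivative rate t * \<rho> t) (at t within {t0..})" if "t \<ge> t0" for t
    unfolding \<rho>_def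
    by (rule derivative_eq_intros integral_has_real_derivative_atLeast[OF rc that] refl)+ simp
  have mono: "\<rho> s \<le> \<rho> t" if "s \<le> t" "s \<ge> t0" for s t
    unfolding \<rho>_def using M that t0
    by (auto intro!: mult_left_mono integral_subset_le rate_integrable rate_nonneg)
  have \<rho>0: "\<rho> t0 = M" by (simp add: \<rho>_def)
  have "\<bar>x t\<bar> < \<rho> t \<and> \<bar>y t\<bar> < \<rho> t"
  proof (rule barrier[where x = x and y = y and dx = dx and dy = dy and \<rho> = \<rho> and t = t
        and a = "\<lambda>_. 0" and b = "\<lambda>_. 0" and T = t0 and d\<rho> = "\<lambda>t. rate t * \<rho> t"])
    fix r assume r: "r \<ge> t0" and le: "\<And>s. s \<in> {t0..r} \<Longrightarrow> \<bar>x s\<bar> \<le> \<rho> s \<and> \<bar>y s\<bar> \<le> \<rho> s"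
    have "\<bar>x s\<bar> \<le> \<rho> r \<and> \<bar>y s\<bar> \<le> \<rho> r" if s: "s \<in> {r - \<tau>..r}" for s
    proof (cases "s \<ge> t0")
      case True
      with s le[of s] mono[of s r] show ?thesis by auto
    next
      case False
      with s r init[of s] mono[of t0 r] \<rho>0 show ?thesis by auto
    qed
    from trajectory_deriv_bound[OF tr r this]
    have "\<bar>dx r\<bar> \<le> (a r + p r) * \<rho> r \<and> \<bar>dy r\<bar> \<le> (b r + q r) * \<rho> r" by blast
    moreover have "0 \<le> (a r + p r) * \<rho> r" "0 \<le> (b r + q r) * \<rho> r"
      using pos[of r] nonneg[of r] r t0 M by (auto simp: \<rho>_def)
    moreover have "rate r * \<rho> r = (a r + p r) * \<rho> r + (b r + q r) * \<rho> r"
      by (simp add: rate_def algebra_simps)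
    ultimately show "\<bar>dx r + 0 * x r\<bar> \<le> rate r * \<rho> r + 0 * \<rho> r \<and>
        \<bar>dy r + 0 * y r\<bar> \<le> rate r * \<rho> r + 0 * \<rho> r"
      by auto
  qed (use tr d\<rho> \<rho>0 init[of t0] tau t in \<open>auto simp: trajectory_def\<close>)
  then show ?thesis by (simp add: \<rho>_def)
qed

lemma trajectory_below_until:
  assumes tr: "trajectory t0 x y dx dy"
    and init: "\<And>s. s \<in> {t0 - \<tau>..t0} \<Longrightarrow> \<bar>x s\<bar> < M \<and> \<bar>y s\<bar> < M"
    and D: "integral {t0..S} rate \<le> D" "D \<ge> 0"
    and t: "t \<in> {t0 - \<tau>..S}"
  shows "\<bar>x t\<bar> < M * exp D \<and> \<bar>y t\<bar> < M * exp D"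
proof -
  have M: "M > 0" using init[of t0] tau by auto
  have t0: "t0 \<ge> 0" using tr by (simp add: trajectory_def)
  show ?thesis
  proof (cases "t \<ge> t0")
    case True
    have "integral {t0..t} rate \<le> integral {t0..S} rate"
      using t True t0 by (intro integral_subset_le rate_integrable) (auto intro!: rate_nonneg)
    then have "M * exp (integral {t0..t} rate) \<le> M * exp D" using D M by simp
    with trajectory_growth[OF tr init True] show ?thesis by force
  next
    case False
    have "M \<le> M * exp D" using M D by simp
    with init[of t] False t show ?thesis by force
  qed
qed

text \<open>The window has length \<open>2\<tau>\<close> since the derivative is integrated over \<open>[t - \<tau>, t]\<close> and itself
  looks back by \<open>\<tau>\<close>; the condition \<open>t \<ge> t0 + \<tau>\<close> ensures that the equation holds on
  \<open>[t - \<tau>, t]\<close>.\<close>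

lemma residual_bound:
  assumes tr: "trajectory t0 x y dx dy" and t: "t \<ge> t0 + \<tau>" and con: "contracting \<theta> T" and tT: "t \<ge> T"
    and le: "\<And>s. s \<in> {t - 2*\<tau>..t} \<Longrightarrow> \<bar>x s\<bar> \<le> N \<and> \<bar>y s\<bar> \<le> N"
  shows "\<bar>dx t + a t * x t\<bar> \<le> a t * \<theta> * N \<and> \<bar>dy t + b t * y t\<bar> \<le> b t * \<theta> * N"
proof -
  have t0: "t0 \<ge> 0" using tr by (simp add: trajectory_def)
  have N: "N \<ge> 0" using le[of t] tau by auto
  have bd: "\<bar>dx s\<bar> \<le> (a s + p s) * N \<and> \<bar>dy s\<bar> \<le> (b s + q s) * N" if "s \<in> {t - \<tau>..t}" for s
    using that t by (intro trajectory_deriv_bound[OF tr] le) auto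
  have sub: "{t - \<tau>..t} \<subseteq> {t0..}" "{t - \<tau>..t} \<subseteq> {0..}" using t t0 by auto
  have d: "(x has_real_derivative dx s) (at s within {t - \<tau>..t})"
    "(y has_real_derivative dy s) (at s within {t - \<tau>..t})" if "s \<in> {t - \<tau>..t}" for s
    using tr that sub(1) by (auto simp: trajectory_def intro: DERIV_subset[OF _ sub(1)])
  have del: "\<bar>dx t + a t * x (t - \<tau>)\<bar> \<le> p t * N" "\<bar>dy t + b t * y (t - \<tau>)\<bar> \<le> q t * N"
    using tr t tau le[of t] le[of "t - \<tau>"] by (auto simp: trajectory_def)
  have small: "p t / a t + integral {t - \<tau>..t} (\<lambda>s. a s + p s) \<le> \<theta>"
    "q t / b t + integral {t - \<tau>..t} (\<lambda>s. b s + q s) \<le> \<theta>"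
    using con tT by (auto simp: contracting_def)
  have c: "continuous_on {t - \<tau>..t} (\<lambda>s. a s + p s)" "continuous_on {t - \<tau>..t} (\<lambda>s. b s + q s)"
    using cont sub(2) by (auto intro!: continuous_intros intro: continuous_on_subset)
  have t': "t - \<tau> \<le> t" "a t > 0" "b t > 0" using tau t t0 pos[of t] by auto
  show ?thesis
    using damping_residual[OF t'(1) c(1) d(1) _ del(1) small(1) t'(2) N]
      damping_residual[OF t'(1) c(2) d(2) _ del(2) small(2) t'(3) N] bd by blast
qed

text \<open>For a decreasing barrier the largest admissible state in the window \<open>[t - 2\<tau>, t]\<close> is
  \<open>\<rho> (t - 2\<tau>)\<close>, so the residual bound makes the barrier impassable under the hypotheses on its
  slope.\<close>

lemma trajectory_trapped:
  assumes tr: "trajectory t0 x y dx dy" and con: "contracting \<theta> T" and S: "S \<ge> T" "S \<ge> t0 + \<tau>"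
    and d\<rho>: "\<And>t. t \<ge> S \<Longrightarrow> (\<rho> has_real_derivative d\<rho> t) (at t within {S..})"
    and anti: "\<And>s t. s \<le> t \<Longrightarrow> \<rho> t \<le> \<rho> s"
    and slope: "\<And>t. t \<ge> S \<Longrightarrow> a t * \<theta> * \<rho> (t - 2*\<tau>) \<le> d\<rho> t + a t * \<rho> t"
      "\<And>t. t \<ge> S \<Longrightarrow> b t * \<theta> * \<rho> (t - 2*\<tau>) \<le> d\<rho> t + b t * \<rho> t"
    and init: "\<And>s. s \<in> {S - 2*\<tau>..S} \<Longrightarrow> \<bar>x s\<bar> < \<rho> s \<and> \<bar>y s\<bar> < \<rho> s"
    and t: "t \<ge> S"
  shows "\<bar>x t\<bar> < \<rho> t \<and> \<bar>y t\<bar> < \<rho> t"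
proof (rule barrier[where x = x and y = y and dx = dx and dy = dy and \<rho> = \<rho> and d\<rho> = d\<rho>
      and a = a and b = b and T = S and t = t])
  have t0: "t0 \<ge> 0" using tr by (simp add: trajectory_def)
  have sub: "{S..} \<subseteq> {t0..}" "{S..} \<subseteq> {0..}" using S t0 tau by auto
  show "continuous_on {S..} a" "continuous_on {S..} b"
    using cont sub by (auto intro: continuous_on_subset)
  show "(x has_real_derivative dx t) (at t within {S..})"
    "(y has_real_derivative dy t) (at t within {S..})" if "t \<ge> S" for t
    using tr that sub(1) by (auto simp: trajectory_def intro: DERIV_subset[OF _ sub(1)])
  show "\<bar>x S\<bar> < \<rho> S" "\<bar>y S\<bar> < \<rho> S" using init[of S] tau by auto
  fix r assume r: "r \<ge> S" and le: "\<And>s. s \<in> {S..r} \<Longrightarrow> \<bar>x s\<bar> \<le> \<rho> s \<and> \<bar>y s\<bar> \<le> \<rho> s"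
  have "\<bar>x s\<bar> \<le> \<rho> (r - 2*\<tau>) \<and> \<bar>y s\<bar> \<le> \<rho> (r - 2*\<tau>)" if s: "s \<in> {r - 2*\<tau>..r}" for s
    using le[of s] init[of s] anti[of "r - 2*\<tau>" s] s r by force
  then have "\<bar>dx r + a r * x r\<bar> \<le> a r * \<theta> * \<rho> (r - 2*\<tau>) \<and>
      \<bar>dy r + b r * y r\<bar> \<le> b r * \<theta> * \<rho> (r - 2*\<tau>)"
    using r S by (intro residual_bound[OF tr _ con]) auto
  with slope[OF r] show "\<bar>dx r + a r * x r\<bar> \<le> d\<rho> r + a r * \<rho> r \<and>
      \<bar>dy r + b r * y r\<bar> \<le> d\<rho> r + b r * \<rho> r"
    by linarith
qed (use d\<rho> t in auto)

text \<open>The constant \<open>C\<close> comes from the growth up to the time \<open>S\<close> at which the residual bound becomes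
  available; from then on a constant barrier holds because \<open>\<theta> < 1\<close>.\<close>

lemma trajectory_bounded:
  assumes con: "contracting \<theta> T" and t0: "t0 \<ge> 0"
  obtains C where "C > 0"
    "\<And>x y dx dy M t. trajectory t0 x y dx dy \<Longrightarrow>
      (\<And>s. s \<in> {t0 - \<tau>..t0} \<Longrightarrow> \<bar>x s\<bar> < M \<and> \<bar>y s\<bar> < M) \<Longrightarrow> t \<ge> t0 \<Longrightarrow>
      \<bar>x t\<bar> < M * C \<and> \<bar>y t\<bar> < M * C"
proof -
  define S where "S = max T (t0 + \<tau>)"
  define D where "D = integral {t0..S} rate"
  have D: "D \<ge> 0" unfolding D_def
    using t0 by (intro integral_nonneg rate_integrable rate_nonneg) auto
  show thesis
  proof (rule that[of "exp D"])
    fix x y dx dy M t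
    assume tr: "trajectory t0 x y dx dy" and t: "t \<ge> t0"
      and init: "\<And>s. s \<in> {t0 - \<tau>..t0} \<Longrightarrow> \<bar>x s\<bar> < M \<and> \<bar>y s\<bar> < M"
    define \<rho> where "\<rho> = M * exp D"
    have \<rho>: "\<rho> > 0" using init[of t0] tau by (auto simp: \<rho>_def)
    have early: "\<bar>x s\<bar> < \<rho> \<and> \<bar>y s\<bar> < \<rho>" if "s \<in> {t0 - \<tau>..S}" for s
      using trajectory_below_until[OF tr init _ D that] by (simp add: D_def \<rho>_def)
    have "\<bar>x t\<bar> < \<rho> \<and> \<bar>y t\<bar> < \<rho>"
    proof (cases "t \<ge> S")
      case True
      show ?thesis
      proof (rule trajectory_trapped[OF tr con _ _ _ _ _ _ _ True, where \<rho> = "\<lambda>_. \<rho>" and d\<rho> = "\<lambda>_. 0"])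
        show "a r * \<theta> * \<rho> \<le> 0 + a r * \<rho>" "b r * \<theta> * \<rho> \<le> 0 + b r * \<rho>" if "r \<ge> S" for r
          using pos[of r] that t0 tau con \<rho>
          by (auto simp: S_def contracting_def mult_le_cancel_left1 mult_le_cancel_right1)
        show "\<bar>x s\<bar> < \<rho> \<and> \<bar>y s\<bar> < \<rho>" if "s \<in> {S - 2*\<tau>..S}" for s
          using that by (intro early) (auto simp: S_def)
      qed (auto simp: S_def)
    next
      case False
      then show ?thesis using early[of t] t tau by auto
    qed
    then show "\<bar>x t\<bar> < M * exp D \<and> \<bar>y t\<bar> < M * exp D" by (simp add: \<rho>_def)
  qed simp
qed

text \<open>The integral of \<open>min a b\<close> may converge even though those of \<open>a\<close> and \<open>b\<close> diverge, and then no
  barrier common to both components decays.  With the bound \<open>M\<close> on the past of both components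
  given, each of them can be compared with a barrier that decays at its own rate.\<close>

lemma trajectory_eventually_smaller:
  assumes tr: "trajectory t0 x y dx dy" and con: "contracting \<theta> T"
    and inf: "filterlim (\<lambda>t. integral {0..t} a) at_top at_top"
      "filterlim (\<lambda>t. integral {0..t} b) at_top at_top"
    and \<eta>: "\<theta> < \<eta>" and M: "M > 0"
    and ev: "\<forall>\<^sub>F t in at_top. \<bar>x t\<bar> < M \<and> \<bar>y t\<bar> < M"
  shows "\<forall>\<^sub>F t in at_top. \<bar>x t\<bar> < \<eta> * M \<and> \<bar>y t\<bar> < \<eta> * M"
proof -
  from ev obtain R where R: "\<And>t. t \<ge> R \<Longrightarrow> \<bar>x t\<bar> < M \<and> \<bar>y t\<bar> < M"
    by (auto simp: eventually_at_top_linorder)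
  define S where "S = max (max (R + 2*\<tau>) T) (t0 + \<tau>)"
  have t0: "t0 \<ge> 0" using tr by (simp add: trajectory_def)
  have S0: "S \<ge> 0" using t0 tau by (auto simp: S_def)
  have sub: "{S..} \<subseteq> {t0..}" "{S..} \<subseteq> {0..}" using S0 tau by (auto simp: S_def)
  have d: "(x has_real_derivative dx t) (at t within {S..})"
    "(y has_real_derivative dy t) (at t within {S..})" if "t \<ge> S" for t
    using tr that sub(1) by (auto simp: trajectory_def intro: DERIV_subset[OF _ sub(1)])
  have le: "\<bar>x s\<bar> \<le> M \<and> \<bar>y s\<bar> \<le> M" if "s \<ge> S - 2*\<tau>" for s
  proof -
    have "s \<ge> R" using that by (auto simp: S_def)
    with R[of s] show ?thesis by auto
  qed
  have res: "\<bar>dx t + a t * x t\<bar> \<le> a t * (\<theta> * M)" "\<bar>dy t + b t * y t\<bar> \<le> b t * (\<theta> * M)"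
    if t: "t \<ge> S" for t
  proof -
    have "\<bar>dx t + a t * x t\<bar> \<le> a t * \<theta> * M \<and> \<bar>dy t + b t * y t\<bar> \<le> b t * \<theta> * M"
      using t by (intro residual_bound[OF tr _ con] le) (auto simp: S_def)
    then show "\<bar>dx t + a t * x t\<bar> \<le> a t * (\<theta> * M)" "\<bar>dy t + b t * y t\<bar> \<le> b t * (\<theta> * M)"
      by (auto simp: mult.assoc)
  qed
  have N: "0 \<le> \<theta> * M" "\<theta> * M < \<eta> * M"
    using con M \<eta> by (auto simp: contracting_def)
  have ab: "continuous_on {S..} a" "continuous_on {S..} b"
    using cont sub(2) by (auto intro: continuous_on_subset)
  show ?thesis
    using damped_eventually_below[OF ab(1) integral_diverges_from[OF cont(1) inf(1) S0] d(1) res(1) N]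
      damped_eventually_below[OF ab(2) integral_diverges_from[OF cont(2) inf(2) S0] d(2) res(2) N]
    by (rule eventually_conj)
qed

lemma trajectory_tendsto_0:
  assumes tr: "trajectory t0 x y dx dy" and con: "contracting \<theta> T"
    and inf: "filterlim (\<lambda>t. integral {0..t} a) at_top at_top"
      "filterlim (\<lambda>t. integral {0..t} b) at_top at_top"
    and M: "M > 0" and ev: "\<forall>\<^sub>F t in at_top. \<bar>x t\<bar> < M \<and> \<bar>y t\<bar> < M"
  shows "(x \<longlongrightarrow> 0) at_top \<and> (y \<longlongrightarrow> 0) at_top"
proof -
  from con obtain \<eta> where \<eta>: "\<theta> < \<eta>" "\<eta> < 1" "0 < \<eta>"
    by (auto simp: contracting_def dest: dense intro: less_trans)
  have geo: "\<forall>\<^sub>F t in at_top. \<bar>x t\<bar> < \<eta> ^ n * M \<and> \<bar>y t\<bar> < \<eta> ^ n * M" for n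
  proof (induction n)
    case (Suc n)
    from trajectory_eventually_smaller[OF tr con inf \<eta>(1) _ this] M \<eta>(3) show ?case
      by (simp add: mult.assoc)
  qed (use ev in simp)
  have "\<forall>\<^sub>F t in at_top. \<bar>x t\<bar> < e \<and> \<bar>y t\<bar> < e" if e: "e > 0" for e
  proof -
    obtain n where "\<eta> ^ n < e / M"
      using real_arch_pow_inv[of "e / M" \<eta>] e M \<eta> by auto
    then have "\<eta> ^ n * M < e" using M by (simp add: field_simps)
    with geo[of n] show ?thesis by (auto elim!: eventually_mono)
  qed
  then show ?thesis
    by (auto simp: tendsto_iff dist_real_def eventually_conj_iff)
qed

text \<open>As \<open>\<beta>\<close> tends to \<open>0\<close> the right-hand side tends to \<open>\<alpha> * (1 - \<theta>)\<close>, which is positive.\<close>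

lemma exponential_rate_exists:
  assumes "\<alpha> > 0" "\<theta> < 1"
  obtains \<beta> :: real where "\<beta> > 0" "\<beta> \<le> \<alpha> * (1 - \<theta> * exp (2 * \<beta> * \<tau>))"
proof -
  have "((\<lambda>\<beta>. \<alpha> * (1 - \<theta> * exp (2 * \<beta> * \<tau>)) - \<beta>) \<longlongrightarrow> \<alpha> * (1 - \<theta> * exp (2 * 0 * \<tau>)) - 0) (at_right 0)"
    by (intro tendsto_intros)
  then have "\<forall>\<^sub>F \<beta> in at_right 0. \<alpha> * (1 - \<theta> * exp (2 * \<beta> * \<tau>)) - \<beta> > 0"
    by (rule order_tendstoD) (use assms in simp)
  moreover have "\<forall>\<^sub>F \<beta> in at_right (0::real). \<beta> > 0" by (simp add: eventually_at_right_less)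
  ultimately have "\<forall>\<^sub>F \<beta> in at_right (0::real). \<beta> > 0 \<and> \<alpha> * (1 - \<theta> * exp (2 * \<beta> * \<tau>)) - \<beta> > 0"
    by (simp add: eventually_conj)
  then obtain \<beta> :: real where "\<beta> > 0 \<and> \<alpha> * (1 - \<theta> * exp (2 * \<beta> * \<tau>)) - \<beta> > 0"
    using eventually_happens trivial_limit_at_right_real by blast
  then show thesis by (intro that[of \<beta>]) auto
qed

text \<open>This is what makes the constant \<open>K\<close> of exponential stability uniform in the initial time.  For
  \<open>t0 \<le> T\<close> the interval lies in the fixed interval \<open>[0, T + \<tau>]\<close>; for \<open>t0 > T\<close> it has
  length \<open>\<tau>\<close>, and the smallness condition bounds the integrals of \<open>a + p\<close> and of \<open>b + q\<close> by \<open>1\<close>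
  each.\<close>

lemma integral_rate_initial_bounded:
  assumes con: "contracting \<theta> T"
  obtains D where "D \<ge> 0" "\<And>t0. t0 \<ge> 0 \<Longrightarrow> integral {t0..max T (t0 + \<tau>)} rate \<le> D"
proof -
  have T: "T \<ge> \<tau>" using con by (simp add: contracting_def)
  define D where "D = integral {0..T + \<tau>} rate"
  have D: "D \<ge> 0" unfolding D_def
    using T tau by (intro integral_nonneg rate_integrable rate_nonneg) auto
  show thesis
  proof (rule that[of "D + 2"])
    fix t0 :: real assume t0: "t0 \<ge> 0"
    show "integral {t0..max T (t0 + \<tau>)} rate \<le> D + 2"
    proof (cases "t0 \<le> T")
      case True
      have "integral {t0..max T (t0 + \<tau>)} rate \<le> D" unfolding D_def
        using True t0 tau T
        by (intro integral_subset_le rate_integrable) (auto intro!: rate_nonneg)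
      then show ?thesis by simp
    next
      case False
      define t where "t = t0 + \<tau>"
      have t: "t \<ge> T" "t - \<tau> = t0" "t \<ge> 0" using False tau t0 by (auto simp: t_def)
      have i: "(\<lambda>s. a s + p s) integrable_on {t0..t}" "(\<lambda>s. b s + q s) integrable_on {t0..t}"
        by (intro integrable_continuous_real continuous_intros continuous_on_subset[OF cont(1)]
            continuous_on_subset[OF cont(2)] continuous_on_subset[OF cont(3)]
            continuous_on_subset[OF cont(4)]; use t0 in auto)+
      have "p t / a t + integral {t0..t} (\<lambda>s. a s + p s) \<le> 1"
        "q t / b t + integral {t0..t} (\<lambda>s. b s + q s) \<le> 1"
        using con t by (force simp: contracting_def)+
      moreover have "p t / a t \<ge> 0" "q t / b t \<ge> 0"
        using pos[OF t(3)] nonneg[OF t(3)] by auto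
      ultimately have "integral {t0..t} rate \<le> 2"
        unfolding rate_def using integral_add[OF i] by linarith
      then show ?thesis using False D tau by (simp add: t_def max_def)
    qed
  qed (use D in simp)
qed

text \<open>The barrier is \<open>M * exp (D + \<beta> * (T + \<tau>) - \<beta> * (t - t0))\<close>.  Here \<open>exp D\<close> accounts for the
  growth until \<open>S = max T (t0 + \<tau>)\<close>, and the summand \<open>\<beta> * (T + \<tau>)\<close> makes up for the decay
  that the barrier has undergone before \<open>S\<close>, since \<open>S - t0 \<le> T + \<tau>\<close>.\<close>

lemma trajectory_exponential:
  assumes con: "contracting \<theta> T" and \<alpha>: "\<alpha> > 0" "\<And>t. t \<ge> T \<Longrightarrow> a t \<ge> \<alpha> \<and> b t \<ge> \<alpha>"
  obtains K \<beta> where "K > 0" "\<beta> > 0"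
    "\<And>t0 x y dx dy M t. trajectory t0 x y dx dy \<Longrightarrow>
      (\<And>s. s \<in> {t0 - \<tau>..t0} \<Longrightarrow> \<bar>x s\<bar> < M \<and> \<bar>y s\<bar> < M) \<Longrightarrow> t \<ge> t0 \<Longrightarrow>
      \<bar>x t\<bar> < M * (K * exp (- \<beta> * (t - t0))) \<and> \<bar>y t\<bar> < M * (K * exp (- \<beta> * (t - t0)))"
proof -
  have T: "T \<ge> \<tau>" and \<theta>: "0 < \<theta>" "\<theta> < 1" using con by (auto simp: contracting_def)
  obtain \<beta> where \<beta>: "\<beta> > 0" "\<beta> \<le> \<alpha> * (1 - \<theta> * exp (2 * \<beta> * \<tau>))"
    using exponential_rate_exists[OF \<alpha>(1) \<theta>(2)] .
  obtain D where D: "D \<ge> 0" "\<And>t0. t0 \<ge> 0 \<Longrightarrow> integral {t0..max T (t0 + \<tau>)} rate \<le> D"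
    using integral_rate_initial_bounded[OF con] by blast
  have q: "1 - \<theta> * exp (2 * \<beta> * \<tau>) \<ge> 0"
    using \<beta> \<alpha>(1) by (meson less_le_trans less_imp_le zero_less_mult_pos)
  show thesis
  proof (rule that[of "exp (D + \<beta> * (T + \<tau>))" \<beta>])
    fix t0 x y dx dy M t
    assume tr: "trajectory t0 x y dx dy" and t: "t \<ge> t0"
      and init: "\<And>s. s \<in> {t0 - \<tau>..t0} \<Longrightarrow> \<bar>x s\<bar> < M \<and> \<bar>y s\<bar> < M"
    have t0: "t0 \<ge> 0" using tr by (simp add: trajectory_def)
    have M: "M > 0" using init[of t0] tau by auto
    define S where "S = max T (t0 + \<tau>)"
    define \<rho> where "\<rho> t = M * exp (D + \<beta> * (T + \<tau>) - \<beta> * (t - t0))" for t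
    have \<rho>_delay: "\<rho> (r - 2*\<tau>) = exp (2 * \<beta> * \<tau>) * \<rho> r" for r
      by (simp add: \<rho>_def algebra_simps flip: exp_add)
    have early: "\<bar>x s\<bar> < \<rho> s \<and> \<bar>y s\<bar> < \<rho> s" if s: "s \<in> {t0 - \<tau>..S}" for s
    proof -
      have "\<beta> * (s - t0) \<le> \<beta> * (T + \<tau>)"
        using \<beta>(1) s t0 T tau by (intro mult_left_mono) (auto simp: S_def)
      then have "M * exp D \<le> \<rho> s" using M by (simp add: \<rho>_def)
      with trajectory_below_until[OF tr init D(2)[OF t0, folded S_def] D(1) s] show ?thesis by force
    qed
    have slope: "c * \<theta> * \<rho> (r - 2*\<tau>) \<le> - \<beta> * \<rho> r + c * \<rho> r" if "c \<ge> \<alpha>" for c r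
    proof -
      have "\<beta> \<le> c * (1 - \<theta> * exp (2 * \<beta> * \<tau>))"
        using \<beta>(2) mult_right_mono[OF that q] by linarith
      then have "\<beta> * \<rho> r \<le> c * (1 - \<theta> * exp (2 * \<beta> * \<tau>)) * \<rho> r"
        using M by (intro mult_right_mono) (auto simp: \<rho>_def)
      then show ?thesis unfolding \<rho>_delay by (simp add: algebra_simps)
    qed
    have "\<bar>x t\<bar> < \<rho> t \<and> \<bar>y t\<bar> < \<rho> t"
    proof (cases "t \<ge> S")
      case True
      show ?thesis
      proof (rule trajectory_trapped[OF tr con _ _ _ _ _ _ _ True, where d\<rho> = "\<lambda>t. - \<beta> * \<rho> t"])
        show "(\<rho> has_real_derivative - \<beta> * \<rho> r) (at r within {S..})" for r
          unfolding \<rho>_def by (auto intro!: derivative_eq_intros)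
        show "\<rho> r \<le> \<rho> s" if "s \<le> r" for s r
          using that M \<beta>(1) by (simp add: \<rho>_def)
        show "a r * \<theta> * \<rho> (r - 2 * \<tau>) \<le> - \<beta> * \<rho> r + a r * \<rho> r"
          "b r * \<theta> * \<rho> (r - 2 * \<tau>) \<le> - \<beta> * \<rho> r + b r * \<rho> r" if "r \<ge> S" for r
          using \<alpha>(2)[of r] that by (intro slope; simp add: S_def)+
        show "\<bar>x s\<bar> < \<rho> s \<and> \<bar>y s\<bar> < \<rho> s" if "s \<in> {S - 2*\<tau>..S}" for s
          using that by (intro early) (auto simp: S_def)
      qed (auto simp: S_def)
    next
      case False
      then show ?thesis using early[of t] t tau by auto
    qed
    then show "\<bar>x t\<bar> < M * (exp (D + \<beta> * (T + \<tau>)) * exp (- \<beta> * (t - t0))) \<and>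
        \<bar>y t\<bar> < M * (exp (D + \<beta> * (T + \<tau>)) * exp (- \<beta> * (t - t0)))"
      by (simp add: \<rho>_def flip: exp_add)
  qed (use \<beta> in auto)
qed

end

section \<open>Solutions of the planar system\<close>

lemma infnorm_le_sup_norm:
  assumes "\<phi> \<in> initial_functions \<tau>" "\<theta> \<in> {-\<tau>..0}"
  shows "infnorm (\<phi> \<theta>) \<le> sup_norm \<tau> \<phi>"
proof -
  have "compact ((\<lambda>\<theta>. infnorm (\<phi> \<theta>)) ` {-\<tau>..0})"
    using assms(1) by (intro compact_continuous_image continuous_on_infnorm)
      (auto simp: initial_functions_def)
  then have "bdd_above ((\<lambda>\<theta>. infnorm (\<phi> \<theta>)) ` {-\<tau>..0})"
    by (intro bounded_imp_bdd_above compact_imp_bounded)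
  then show ?thesis
    unfolding sup_norm_def using assms(2) by (rule cSUP_upper[rotated])
qed

lemma dde_solution_initial:
  assumes "dde_solution \<tau> F t0 \<phi> X" "\<phi> \<in> initial_functions \<tau>"
    "sup_norm \<tau> \<phi> < M" "s \<in> {t0 - \<tau>..t0}"
  shows "\<bar>fst (X s)\<bar> < M \<and> \<bar>snd (X s)\<bar> < M"
proof -
  have s: "s - t0 \<in> {-\<tau>..0}" using assms(4) by auto
  then have "X (t0 + (s - t0)) = \<phi> (s - t0)" using assms(1) unfolding dde_solution_def by blast
  then have "infnorm (X s) < M" using infnorm_le_sup_norm[OF assms(2) s] assms(3) by simp
  then show ?thesis by (cases "X s") (simp add: infnorm_real2)
qed

lemma eventually_below_Limsup:
  fixes f :: "real \<Rightarrow> real"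
  assumes "Limsup at_top (\<lambda>t. ereal (f t)) < 1"
  obtains \<theta> T where "\<theta> < 1" "\<And>t. t \<ge> T \<Longrightarrow> f t \<le> \<theta>"
proof -
  obtain \<theta> where \<theta>: "Limsup at_top (\<lambda>t. ereal (f t)) < ereal \<theta>" "ereal \<theta> < 1"
    using ereal_dense2[OF assms] by blast
  from Limsup_lessD[OF \<theta>(1)] obtain T where "\<And>t. t \<ge> T \<Longrightarrow> f t < \<theta>"
    by (auto simp: eventually_at_top_linorder)
  with \<theta>(2) show thesis by (intro that[of \<theta> T]) (auto intro: less_imp_le)
qed

lemma eventually_above_Liminf:
  fixes f :: "real \<Rightarrow> real"
  assumes "Liminf at_top (\<lambda>t. ereal (f t)) > 0"
  obtains \<alpha> T where "\<alpha> > 0" "\<And>t. t \<ge> T \<Longrightarrow> f t \<ge> \<alpha>"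
proof -
  obtain \<alpha> where \<alpha>: "ereal \<alpha> < Liminf at_top (\<lambda>t. ereal (f t))" "0 < ereal \<alpha>"
    using ereal_dense2[OF assms] by blast
  from less_LiminfD[OF \<alpha>(1)] obtain T where "\<And>t. t \<ge> T \<Longrightarrow> f t > \<alpha>"
    by (auto simp: eventually_at_top_linorder)
  with \<alpha>(2) show thesis by (intro that[of \<alpha> T]) (auto intro: less_imp_le)
qed

theorem theorem3p2:
  fixes \<tau> b1 b2 :: real
    and a b k l G H :: "real \<Rightarrow> real"
    and g h :: "real \<Rightarrow> real \<times> real \<times> real \<times> real \<Rightarrow> real"
  assumes tau_pos: "\<tau> > 0"
    and cont_coeffs: "continuous_on {0..} a" "continuous_on {0..} b"
      "continuous_on {0..} k" "continuous_on {0..} l"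
    and pos_coeffs: "\<And>t. t \<ge> 0 \<Longrightarrow> a t > 0" "\<And>t. t \<ge> 0 \<Longrightarrow> b t > 0"
    and nonneg_coeffs: "\<And>t. t \<ge> 0 \<Longrightarrow> k t \<ge> 0" "\<And>t. t \<ge> 0 \<Longrightarrow> l t \<ge> 0"
    and cont_gh: "continuous_on ({0..} \<times> UNIV) (\<lambda>(t, z). g t z)"
      "continuous_on ({0..} \<times> UNIV) (\<lambda>(t, z). h t z)"
    and nonneg_gh: "\<And>t z. t \<ge> 0 \<Longrightarrow> g t z \<ge> 0" "\<And>t z. t \<ge> 0 \<Longrightarrow> h t z \<ge> 0"
    and bounds_pos: "b1 > 0" "b2 > 0"
    and bounded_gh:
      "\<And>t x y u v. t \<ge> 0 \<Longrightarrow> x \<ge> 0 \<Longrightarrow> y \<ge> 0 \<Longrightarrow> u \<ge> 0 \<Longrightarrow> v \<ge> 0 \<Longrightarrow> \<bar>g t (x, y, u, v)\<bar> \<le> b1"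
      "\<And>t x y u v. t \<ge> 0 \<Longrightarrow> x \<ge> 0 \<Longrightarrow> y \<ge> 0 \<Longrightarrow> u \<ge> 0 \<Longrightarrow> v \<ge> 0 \<Longrightarrow> \<bar>h t (x, y, u, v)\<bar> \<le> b2"
    and solvable: "uniquely_solvable \<tau> (planar_field a b k l g h)"
    and cont_GH: "continuous_on {0..} G" "continuous_on {0..} H"
    and nonneg_GH: "\<And>t. t \<ge> 0 \<Longrightarrow> G t \<ge> 0" "\<And>t. t \<ge> 0 \<Longrightarrow> H t \<ge> 0"
    and growth_gh: "\<And>t z. t \<ge> 0 \<Longrightarrow> \<bar>g t z\<bar> \<le> G t * infnorm z"
      "\<And>t z. t \<ge> 0 \<Longrightarrow> \<bar>h t z\<bar> \<le> H t * infnorm z"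
    and limsup_B1: "Limsup at_top (\<lambda>t. ereal ((k t + G t) / a t
        + integral {t - \<tau>..t} (\<lambda>s. a s + k s + G s))) < 1"
    and limsup_B2: "Limsup at_top (\<lambda>t. ereal ((l t + H t) / b t
        + integral {t - \<tau>..t} (\<lambda>s. b s + l s + H s))) < 1"
  shows "(filterlim (\<lambda>T. integral {0..T} a) at_top at_top \<and>
          filterlim (\<lambda>T. integral {0..T} b) at_top at_top \<longrightarrow>
            zero_stable \<tau> (planar_field a b k l g h) \<and>
            zero_global_attractor \<tau> (planar_field a b k l g h))
       \<and> (Liminf at_top (\<lambda>t. ereal (a t)) > 0 \<and> Liminf at_top (\<lambda>t. ereal (b t)) > 0 \<longrightarrow>
            zero_globally_exp_stable \<tau> (planar_field a b k l g h))"
proof -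
  let ?F = "planar_field a b k l g h"
  interpret delayed_damping \<tau> a b "\<lambda>t. k t + G t" "\<lambda>t. l t + H t"
    using tau_pos cont_coeffs pos_coeffs nonneg_coeffs cont_GH nonneg_GH
    by unfold_locales (auto intro: continuous_intros)
  have trajectory: "trajectory t0 (\<lambda>t. fst (X t)) (\<lambda>t. snd (X t))
      (\<lambda>t. fst (?F t (X t) (X (t - \<tau>)))) (\<lambda>t. snd (?F t (X t) (X (t - \<tau>))))"
    if t0: "t0 \<ge> 0" and sol: "dde_solution \<tau> ?F t0 \<phi> X" for t0 \<phi> X
    unfolding trajectory_def
  proof (intro conjI allI impI)
    fix t assume t: "t \<ge> t0"
    then have d: "(X has_vector_derivative ?F t (X t) (X (t - \<tau>))) (at t within {t0..})"
      using sol by (simp add: dde_solution_def)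
    show "((\<lambda>t. fst (X t)) has_real_derivative fst (?F t (X t) (X (t - \<tau>)))) (at t within {t0..})"
      using bounded_linear.has_vector_derivative[OF bounded_linear_fst d]
      by (simp add: has_real_derivative_iff_has_vector_derivative)
    show "((\<lambda>t. snd (X t)) has_real_derivative snd (?F t (X t) (X (t - \<tau>)))) (at t within {t0..})"
      using bounded_linear.has_vector_derivative[OF bounded_linear_snd d]
      by (simp add: has_real_derivative_iff_has_vector_derivative)
    obtain x y where X: "X t = (x, y)" by fastforce
    obtain u v where X\<tau>: "X (t - \<tau>) = (u, v)" by fastforce
    fix N assume "\<forall>s\<in>{t - \<tau>, t}. \<bar>fst (X s)\<bar> \<le> N \<and> \<bar>snd (X s)\<bar> \<le> N"
    then have N: "\<bar>x\<bar> \<le> N" "\<bar>y\<bar> \<le> N" "\<bar>u\<bar> \<le> N" "\<bar>v\<bar> \<le> N" by (auto simp: X X\<tau>)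
    have t': "t \<ge> 0" using t t0 by simp
    have "\<bar>g t (x, y, u, v)\<bar> \<le> G t * N"
      using growth_gh(1)[OF t', of "(x, y, u, v)"] nonneg_GH(1)[OF t'] N
      by (elim order_trans) (auto simp: infnorm_real4 intro!: mult_left_mono)
    moreover have "\<bar>h t (y, x, v, u)\<bar> \<le> H t * N"
      using growth_gh(2)[OF t', of "(y, x, v, u)"] nonneg_GH(2)[OF t'] N
      by (elim order_trans) (auto simp: infnorm_real4 intro!: mult_left_mono)
    moreover have "\<bar>k t * v\<bar> \<le> k t * N" "\<bar>l t * u\<bar> \<le> l t * N"
      using nonneg_coeffs[OF t'] N by (auto simp: abs_mult intro!: mult_left_mono)
    ultimately
    show "\<bar>fst (?F t (X t) (X (t - \<tau>))) + a t * fst (X (t - \<tau>))\<bar> \<le> (k t + G t) * N"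
      "\<bar>snd (?F t (X t) (X (t - \<tau>))) + b t * snd (X (t - \<tau>))\<bar> \<le> (l t + H t) * N"
      by (auto simp: X X\<tau> planar_field_def algebra_simps)
  qed (fact t0)
  obtain \<theta>1 T1 where B1: "\<theta>1 < 1" "\<And>t. t \<ge> T1 \<Longrightarrow>
      (k t + G t) / a t + integral {t - \<tau>..t} (\<lambda>s. a s + k s + G s) \<le> \<theta>1"
    using eventually_below_Limsup[OF limsup_B1] by blast
  obtain \<theta>2 T2 where B2: "\<theta>2 < 1" "\<And>t. t \<ge> T2 \<Longrightarrow>
      (l t + H t) / b t + integral {t - \<tau>..t} (\<lambda>s. b s + l s + H s) \<le> \<theta>2"
    using eventually_below_Limsup[OF limsup_B2] by blast
  \<comment> \<open>The value \<open>1/2\<close> only serves to make \<open>\<theta>\<close> positive.\<close>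
  define \<theta> where "\<theta> = max (1/2) (max \<theta>1 \<theta>2)"
  have con: "contracting \<theta> T" if "T \<ge> max \<tau> (max T1 T2)" for T
    unfolding contracting_def
  proof (intro conjI allI impI)
    fix t assume "t \<ge> T"
    then show "(k t + G t) / a t + integral {t - \<tau>..t} (\<lambda>s. a s + (k s + G s)) \<le> \<theta>"
      "(l t + H t) / b t + integral {t - \<tau>..t} (\<lambda>s. b s + (l s + H s)) \<le> \<theta>"
      using B1(2)[of t] B2(2)[of t] that by (auto simp: \<theta>_def add.assoc)
  qed (use that B1(1) B2(1) in \<open>auto simp: \<theta>_def\<close>)
  note con0 = con[OF order_refl]
  have stable: "zero_stable \<tau> ?F"
    unfolding zero_stable_def
  proof (intro allI impI)
    fix t0 \<epsilon> :: real assume t0: "t0 \<ge> 0" and \<epsilon>: "\<epsilon> > 0"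
    obtain C where C: "C > 0"
      "\<And>x y dx dy M t. trajectory t0 x y dx dy \<Longrightarrow>
        (\<And>s. s \<in> {t0 - \<tau>..t0} \<Longrightarrow> \<bar>x s\<bar> < M \<and> \<bar>y s\<bar> < M) \<Longrightarrow> t \<ge> t0 \<Longrightarrow>
        \<bar>x t\<bar> < M * C \<and> \<bar>y t\<bar> < M * C"
      using trajectory_bounded[OF con0 t0] by blast
    show "\<exists>\<delta>>0. \<forall>\<phi>\<in>initial_functions \<tau>. \<forall>X. dde_solution \<tau> ?F t0 \<phi> X \<longrightarrow>
        sup_norm \<tau> \<phi> < \<delta> \<longrightarrow> (\<forall>t\<ge>t0. infnorm (X t) < \<epsilon>)"
    proof (intro exI[of _ "\<epsilon> / C"] conjI ballI allI impI)
      fix \<phi> X t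
      assume \<phi>: "\<phi> \<in> initial_functions \<tau>" and sol: "dde_solution \<tau> ?F t0 \<phi> X"
        and small: "sup_norm \<tau> \<phi> < \<epsilon> / C" and t: "t \<ge> t0"
      have "\<bar>fst (X t)\<bar> < \<epsilon> / C * C \<and> \<bar>snd (X t)\<bar> < \<epsilon> / C * C"
        by (rule C(2)[OF trajectory[OF t0 sol] dde_solution_initial[OF sol \<phi> small] t])
      then show "infnorm (X t) < \<epsilon>"
        using C(1) by (cases "X t") (simp add: infnorm_real2)
    qed (use \<epsilon> C(1) in simp)
  qed
  have attractor: "zero_global_attractor \<tau> ?F"
    if inf: "filterlim (\<lambda>T. integral {0..T} a) at_top at_top"
      "filterlim (\<lambda>T. integral {0..T} b) at_top at_top"
    unfolding zero_global_attractor_def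
  proof (intro allI impI ballI)
    fix t0 \<phi> X assume t0: "(t0::real) \<ge> 0" and \<phi>: "\<phi> \<in> initial_functions \<tau>"
      and sol: "dde_solution \<tau> ?F t0 \<phi> X"
    obtain C where C: "C > 0"
      "\<And>x y dx dy M t. trajectory t0 x y dx dy \<Longrightarrow>
        (\<And>s. s \<in> {t0 - \<tau>..t0} \<Longrightarrow> \<bar>x s\<bar> < M \<and> \<bar>y s\<bar> < M) \<Longrightarrow> t \<ge> t0 \<Longrightarrow>
        \<bar>x t\<bar> < M * C \<and> \<bar>y t\<bar> < M * C"
      using trajectory_bounded[OF con0 t0] by blast
    define M where "M = sup_norm \<tau> \<phi> + 1"
    have bd: "\<bar>fst (X t)\<bar> < M * C \<and> \<bar>snd (X t)\<bar> < M * C" if "t \<ge> t0" for t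
      by (rule C(2)[OF trajectory[OF t0 sol] dde_solution_initial[OF sol \<phi>] that]) (auto simp: M_def)
    then have "\<forall>\<^sub>F t in at_top. \<bar>fst (X t)\<bar> < M * C \<and> \<bar>snd (X t)\<bar> < M * C"
      by (rule eventually_at_top_linorderI)
    moreover have "M * C > 0" using bd[of t0] by force
    ultimately have "((\<lambda>t. fst (X t)) \<longlongrightarrow> 0) at_top \<and> ((\<lambda>t. snd (X t)) \<longlongrightarrow> 0) at_top"
      using trajectory_tendsto_0[OF trajectory[OF t0 sol] con0 inf] by blast
    then have "((\<lambda>t. (fst (X t), snd (X t))) \<longlongrightarrow> (0, 0)) at_top"
      using tendsto_Pair by blast
    then show "(X \<longlongrightarrow> 0) at_top" by (simp add: zero_prod_def)
  qed
  have exponential: "zero_globally_exp_stable \<tau> ?F"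
    if li: "Liminf at_top (\<lambda>t. ereal (a t)) > 0" "Liminf at_top (\<lambda>t. ereal (b t)) > 0"
  proof -
    obtain \<alpha>1 S1 where \<alpha>1: "\<alpha>1 > 0" "\<And>t. t \<ge> S1 \<Longrightarrow> a t \<ge> \<alpha>1"
      using eventually_above_Liminf[OF li(1)] by blast
    obtain \<alpha>2 S2 where \<alpha>2: "\<alpha>2 > 0" "\<And>t. t \<ge> S2 \<Longrightarrow> b t \<ge> \<alpha>2"
      using eventually_above_Liminf[OF li(2)] by blast
    define T where "T = max (max \<tau> (max T1 T2)) (max S1 S2)"
    have "contracting \<theta> T" by (rule con) (simp add: T_def)
    moreover have "min \<alpha>1 \<alpha>2 > 0" using \<alpha>1(1) \<alpha>2(1) by simp
    moreover have "a t \<ge> min \<alpha>1 \<alpha>2 \<and> b t \<ge> min \<alpha>1 \<alpha>2" if "t \<ge> T" for t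
      using \<alpha>1(2)[of t] \<alpha>2(2)[of t] that by (auto simp: T_def)
    ultimately obtain K \<beta> where K: "K > 0" "\<beta> > 0"
      "\<And>t0 x y dx dy M t. trajectory t0 x y dx dy \<Longrightarrow>
        (\<And>s. s \<in> {t0 - \<tau>..t0} \<Longrightarrow> \<bar>x s\<bar> < M \<and> \<bar>y s\<bar> < M) \<Longrightarrow> t \<ge> t0 \<Longrightarrow>
        \<bar>x t\<bar> < M * (K * exp (- \<beta> * (t - t0))) \<and> \<bar>y t\<bar> < M * (K * exp (- \<beta> * (t - t0)))"
      using trajectory_exponential by blast
    show ?thesis
      unfolding zero_globally_exp_stable_def
    proof (rule exI[of _ K], intro conjI K(1), rule exI[of _ \<beta>],
        intro conjI K(2) allI impI ballI)
      fix t0 \<phi> X t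
      assume t0: "(t0::real) \<ge> 0" and \<phi>: "\<phi> \<in> initial_functions \<tau>"
        and sol: "dde_solution \<tau> ?F t0 \<phi> X" and t: "t \<ge> t0"
      define E where "E = K * exp (- \<beta> * (t - t0))"
      have E: "E > 0" using K(1) by (simp add: E_def)
      \<comment> \<open>The estimates for trajectories ask for strict bounds on the initial function, so
        \<open>sup_norm \<tau> \<phi>\<close> is approached by its upper bounds \<open>M\<close>.\<close>
      have "infnorm (X t) / E \<le> sup_norm \<tau> \<phi>"
      proof (rule dense_ge)
        fix M assume M: "sup_norm \<tau> \<phi> < M"
        have "\<bar>fst (X t)\<bar> < M * E \<and> \<bar>snd (X t)\<bar> < M * E"
          unfolding E_def by (rule K(3)[OF trajectory[OF t0 sol] dde_solution_initial[OF sol \<phi> M] t])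
        then have "infnorm (X t) \<le> M * E"
          by (cases "X t") (simp add: infnorm_real2)
        then show "infnorm (X t) / E \<le> M" using E by (simp add: field_simps)
      qed
      then have "infnorm (X t) \<le> E * sup_norm \<tau> \<phi>" using E by (simp add: field_simps)
      then show "infnorm (X t) \<le> K * exp (- \<beta> * (t - t0)) * sup_norm \<tau> \<phi>"
        by (simp only: E_def)
    qed
  qed
  show ?thesis using stable attractor exponential by blast
qed

end
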